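(* Let $p$ be a prime, $q=p^r$ with $r\ge1$, let $k>1$ be an integer and $D=p^{\lfloor\log_p(k)\rfloor+1}$, $\xi_D=\exp(2\pi i/D)$. For integers $0\le a_{q-1}\le\dots\le a_2\le a_1\le D-1$, let $M_{a_1,\dots,a_{q-1}}(X)$ be the minimal polynomial (over $\mathbb{Q}$) of the algebraic integer $1+\xi_D^{a_1}+\cdots+\xi_D^{a_{q-1}}$. Then the sequence $\{S_{\mathbb{F}_q}(\boldsymbol{e}_{n,k})\}_{n\ge1}$ satisfies the linear recurrence with integer coefficients whose characteristic polynomial is $$\chi_{q,k}(X)=\operatorname{lcm}\left(M_{a_1,\dots,a_{q-1}}(X)\right)_{0\leq a_{q-1}\leq \cdots \leq a_2\leq a_1 \leq D-1}.$$
   Context: $\boldsymbol{e}_{n,k}=\sum_{1\le i_1<\dots<i_k\le n}X_{i_1}\cdots X_{i_k}$ is the elementary symmetric polynomial of degree $k$ in $n$ variables over $\mathbb{F}_q$. For $F:\mathbb{F}_q^n\to\mathbb{F}_q$, $S_{\mathbb{F}_q}(F)=\sum_{\mathbf{x}\in\mathbb{F}_q^n}\exp\!\big(\tfrac{2\pi i}{p}\mathrm{Tr}_{\mathbb{F}_q/\mathbb{F}_p}(F(\mathbf{x}))\big)$, with the trace $\mathrm{Tr}_{\mathbb{F}_q/\mathbb{F}_p}(\alpha)=\sum_{j=0}^{r-1}\alpha^{p^j}$ taking values in $\mathbb{F}_p=\{0,\dots,p-1\}$. *)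

theory Defs
  imports
    Complex_Main
    "HOL-Library.FuncSet"
    "HOL-Library.Cardinality"
    "HOL-Computational_Algebra.Computational_Algebra"
    "HOL-Computational_Algebra.Field_as_Ring"
begin

text \<open>
  A point of \<open>F\<^sub>q\<^sup>n\<close> is an element of \<open>{1..n} \<rightarrow>\<^sub>E UNIV\<close>; index sets
  \<open>i\<^sub>1 < \<dots> < i\<^sub>k\<close> are identified with the \<open>k\<close>-element subsets of \<open>{1..n}\<close>.
\<close>

definition elem_sym :: "nat \<Rightarrow> nat \<Rightarrow> (nat \<Rightarrow> 'a::comm_ring_1) \<Rightarrow> 'a" where
  "elem_sym n k x = (\<Sum>A | A \<subseteq> {1..n} \<and> card A = k. \<Prod>i\<in>A. x i)"

definition field_trace :: "nat \<Rightarrow> nat \<Rightarrow> 'a::finite_field \<Rightarrow> 'a" where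
  "field_trace p r \<alpha> = (\<Sum>j<r. \<alpha> ^ (p ^ j))"

text \<open>
  The trace lies in the prime field, whose elements are the images \<open>of_nat m\<close> of
  \<open>m \<in> {0..p-1}\<close>; the exponential uses this representative \<open>m\<close>.
\<close>

definition trace_rep :: "nat \<Rightarrow> nat \<Rightarrow> 'a::finite_field \<Rightarrow> nat" where
  "trace_rep p r \<alpha> = (THE m. m < p \<and> of_nat m = field_trace p r \<alpha>)"

definition exp_sum :: "nat \<Rightarrow> nat \<Rightarrow> nat \<Rightarrow> ((nat \<Rightarrow> 'a::finite_field) \<Rightarrow> 'a) \<Rightarrow> complex" where
  "exp_sum p r n F =
     (\<Sum>x \<in> {1..n} \<rightarrow>\<^sub>E UNIV.
        exp (2 * of_real pi * \<i> / of_nat p * of_nat (trace_rep p r (F x))))"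

definition min_poly_rat :: "complex \<Rightarrow> rat poly" where
  "min_poly_rat z = (THE P. lead_coeff P = 1 \<and> poly (map_poly of_rat P) z = 0 \<and>
     (\<forall>Q. Q \<noteq> 0 \<and> poly (map_poly of_rat Q) z = 0 \<longrightarrow> degree P \<le> degree Q))"

definition D_of :: "nat \<Rightarrow> nat \<Rightarrow> nat" where
  "D_of p k = p ^ (nat \<lfloor>log (real p) (real k)\<rfloor> + 1)"

definition root_xi :: "nat \<Rightarrow> complex" where
  "root_xi D = exp (2 * of_real pi * \<i> / of_nat D)"

definition M_poly :: "nat \<Rightarrow> nat \<Rightarrow> (nat \<Rightarrow> nat) \<Rightarrow> rat poly" where
  "M_poly q D a = min_poly_rat (1 + (\<Sum>i=1..q-1. root_xi D ^ a i))"

text \<open>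
  Only the values \<open>a 1, \<dots>, a (q-1)\<close> matter, so the set below is finite. On \<open>rat poly\<close>,
  \<open>Lcm\<close> is normalised to be monic.
\<close>

definition chi_poly :: "nat \<Rightarrow> nat \<Rightarrow> nat \<Rightarrow> rat poly" where
  "chi_poly p q k = Lcm {M_poly q (D_of p k) a | a.
     (\<forall>i\<in>{1..q-1}. a i \<le> D_of p k - 1) \<and>
     (\<forall>i\<in>{1..q-1}. \<forall>j\<in>{1..q-1}. i \<le> j \<longrightarrow> a j \<le> a i)}"

text \<open>
  The recurrence \<open>s (n + d) = c (d-1) * s (n + d - 1) + \<dots> + c 0 * s n\<close> has
  characteristic polynomial \<open>X^d - c (d-1) * X^(d-1) - \<dots> - c 0\<close>.
\<close>

definition rec_char_poly :: "nat \<Rightarrow> (nat \<Rightarrow> int) \<Rightarrow> int poly" where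
  "rec_char_poly d c = monom 1 d - (\<Sum>i<d. monom (c i) i)"

definition satisfies_int_recurrence :: "(nat \<Rightarrow> complex) \<Rightarrow> nat \<Rightarrow> (nat \<Rightarrow> int) \<Rightarrow> bool" where
  "satisfies_int_recurrence s d c \<longleftrightarrow>
     (\<forall>n\<ge>1. s (n + d) = (\<Sum>i<d. of_int (c i) * s (n + i)))"

end

theory Submission
  imports Defs "Jordan_Normal_Form.Char_Poly" "HOL-Number_Theory.Residues"
begin

text \<open>
  The value \<open>e\<^sub>n\<^sub>,\<^sub>k(x)\<close> is the coefficient of \<open>t\<^sup>k\<close> in the product of \<open>(1 + v t)\<close> to the power
  \<open>m v\<close> over the field elements \<open>v\<close>, where \<open>m v\<close> counts the coordinates of \<open>x\<close> equal to \<open>v\<close>.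
  Since \<open>(1 + v t)\<^sup>D = 1 + v\<^sup>D t\<^sup>D\<close> in characteristic \<open>p\<close> and \<open>k < D\<close>, only the residues of
  \<open>m v\<close> modulo \<open>D\<close> for \<open>v \<noteq> 0\<close> matter. Fourier expansion over these residues turns the
  exponential sum into a combination, with coefficients independent of \<open>n\<close>, of \<open>n\<close>-th powers of
  the numbers \<open>1 + \<Sum>\<^sub>v \<xi>\<^sup>a\<^sup>(\<^sup>v\<^sup>)\<close>, all of which are roots of \<open>\<chi>\<close>. These numbers are algebraic
  integers, so \<open>\<chi>\<close> divides a monic integer polynomial and has integer coefficients by Gauss's lemma.
\<close>

hide_const (open) up_ring.coeff up_ring.monom module.smult

section \<open>Elementary symmetric polynomials as coefficients; reduction of multiplicities modulo
  \<open>D\<close>\<close>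

lemma elem_sym_eq_coeff:
  "elem_sym n k x = coeff (\<Prod>i\<in>{1..n}. [:1, x i:]) k"
proof -
  have "(\<Prod>i\<in>{1..n}. [:1, x i:]) = (\<Prod>i\<in>{1..n}. monom (x i) 1 + 1)"
    by (intro prod.cong) (simp_all add: monom_Suc one_pCons monom_0)
  also have "\<dots> = (\<Sum>A\<in>Pow {1..n}. \<Prod>i\<in>A. monom (x i) 1)"
    by (subst prod_add) simp_all
  also have "\<dots> = (\<Sum>A\<in>Pow {1..n}. monom (\<Prod>i\<in>A. x i) (card A))"
  proof (intro sum.cong refl)
    fix A assume "A \<in> Pow {1..n}"
    then have "finite A" by (auto intro: finite_subset)
    then show "(\<Prod>i\<in>A. monom (x i) 1) = monom (\<Prod>i\<in>A. x i) (card A)"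
      by (induction A rule: finite_induct) (simp_all add: mult_monom)
  qed
  finally have "coeff (\<Prod>i\<in>{1..n}. [:1, x i:]) k =
      (\<Sum>A\<in>Pow {1..n}. if card A = k then \<Prod>i\<in>A. x i else 0)"
    by (simp add: coeff_sum)
  also have "\<dots> = (\<Sum>A | A \<subseteq> {1..n} \<and> card A = k. \<Prod>i\<in>A. x i)"
    by (subst sum.inter_filter [symmetric]) (auto simp: Pow_def intro!: sum.cong)
  finally show ?thesis by (simp add: elem_sym_def)
qed

text \<open>Serves twice: for the generating polynomial with factors \<open>[:1, x i:]\<close>, and
  for the product of the character weights \<open>w a (x i)\<close>, so that both are expressed
  through the same multiplicities.\<close>

lemma prod_eq_prod_power_card_fibre:
  fixes x :: "'i \<Rightarrow> 'a::finite"
  assumes "finite A"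
  shows "(\<Prod>i\<in>A. f (x i)) = (\<Prod>v\<in>UNIV. f v ^ card {i\<in>A. x i = v})"
proof -
  have "(\<Prod>i\<in>A. f (x i)) = (\<Prod>v\<in>UNIV. \<Prod>i | i \<in> A \<and> x i = v. f (x i))"
    using assms by (subst prod.group) auto
  also have "\<dots> = (\<Prod>v\<in>UNIV. f v ^ card {i\<in>A. x i = v})"
    by (intro prod.cong) auto
  finally show ?thesis .
qed

lemma linear_power_char:
  fixes b :: "'a::comm_ring_1"
  assumes "prime CHAR('a)"
  shows "[:1, b:] ^ (CHAR('a) ^ e) = 1 + monom (b ^ (CHAR('a) ^ e)) (CHAR('a) ^ e)"
proof -
  have "[:1, b:] = 1 + monom b 1"
    by (simp add: monom_Suc one_pCons monom_0)
  also have "\<dots> ^ (CHAR('a) ^ e) = 1 + monom b 1 ^ (CHAR('a) ^ e)"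
    using freshmans_dream'[of "CHAR('a) ^ e" e "1 :: 'a poly" "monom b 1"] assms by simp
  finally show ?thesis by (simp add: monom_power)
qed

text \<open>The condition \<open>t dvd P v - 1\<close> encodes the congruence of \<open>P v\<close>
  to 1 modulo \<open>t\<close>, which is stable under products.\<close>

lemma dvd_prod_diff_1:
  fixes P :: "'b \<Rightarrow> 'a::comm_ring_1"
  assumes "\<And>v. v \<in> A \<Longrightarrow> t dvd P v - 1"
  shows "t dvd (\<Prod>v\<in>A. P v) - 1"
  using assms
proof (induction A rule: infinite_finite_induct)
  case (insert v A)
  have "(\<Prod>v\<in>insert v A. P v) - 1 = P v * ((\<Prod>v\<in>A. P v) - 1) + (P v - 1)"
    using insert.hyps by (simp add: algebra_simps)
  then show ?case using insert by (metis dvd_add dvd_mult insertCI)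
qed auto

lemma dvd_power_diff_1:
  fixes P :: "'a::comm_ring_1"
  assumes "t dvd P - 1"
  shows "t dvd P ^ m - 1"
  using dvd_prod_diff_1[of "{..<m}" t "\<lambda>_. P"] assms by simp

lemma coeff_prod_linear_power_mod:
  fixes m :: "'a::finite_field \<Rightarrow> nat"
  assumes "D = CHAR('a) ^ e" and "k < D"
  shows "coeff (\<Prod>v\<in>UNIV. [:1, v:] ^ m v) k =
         coeff (\<Prod>v\<in>UNIV - {0}. [:1, v:] ^ (m v mod D)) k"
proof -
  define U where "U = (\<Prod>v\<in>UNIV - {0}. ([:1, v:] ^ D) ^ (m v div D))"
  define V where "V = (\<Prod>v\<in>UNIV - {0}. [:1, v:] ^ (m v mod D))"
  have "(\<Prod>v\<in>UNIV. [:1, v:] ^ m v) = (\<Prod>v\<in>UNIV - {0}. [:1, v:] ^ m v)"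
    \<comment> \<open>The value 0 contributes the constant factor 1, whatever its
      multiplicity.\<close>
    by (intro prod.mono_neutral_right) (auto simp flip: one_pCons)
  also have "\<dots> = U * V"
    unfolding U_def V_def prod.distrib [symmetric]
    by (intro prod.cong) (simp_all flip: power_mult power_add)
  finally have split: "(\<Prod>v\<in>UNIV. [:1, v:] ^ m v) = U * V" .
  have "monom 1 D dvd U - 1"
    unfolding U_def
  proof (rule dvd_prod_diff_1, rule dvd_power_diff_1)
    fix v :: 'a
    have "[:1, v:] ^ D - 1 = monom 1 D * [:v ^ D:]"
      using linear_power_char[of v e] assms(1) by (simp add: mult_monom flip: monom_0)
    then show "monom 1 D dvd [:1, v:] ^ D - 1" by (metis dvd_triv_left)
  qed
  then obtain R where "U - 1 = monom 1 D * R" by (elim dvdE)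
  \<comment> \<open>\<open>U * V\<close> and \<open>V\<close> differ by a multiple of
    \<open>t^D\<close>, which the coefficient at \<open>k < D\<close> does not see.\<close>
  then have "U * V = V + monom 1 D * (R * V)" by (simp add: algebra_simps)
  then have "coeff (U * V) k = coeff V k"
    using assms(2) by (simp add: coeff_monom_mult)
  then show ?thesis by (simp add: split V_def)
qed

lemma CHAR_eq_of_card_prime_power:
  assumes "prime p" and "CARD('a::finite_field) = p ^ r"
  shows "CHAR('a) = p"
proof -
  have "prime CHAR('a)" by simp
  moreover have "CHAR('a) dvd p ^ r"
    using CHAR_dvd_CARD[where ?'a='a] assms(2) by simp
  ultimately show ?thesis
    using assms(1) by (metis prime_dvd_power primes_dvd_imp_eq)
qed

text \<open>The exponent in \<open>D_of\<close> is strictly larger than the logarithm of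
  \<open>k\<close> to base \<open>p\<close>, because x is less than its floor plus 1.\<close>

lemma less_D_of:
  assumes "1 < p" and "0 < k"
  shows "k < D_of p k"
proof -
  have "real k = real p powr log (real p) (real k)" using assms by simp
  also have "\<dots> < real p powr (real (nat \<lfloor>log (real p) (real k)\<rfloor> + 1))"
    using assms by (intro powr_less_mono) linarith+
  also have "\<dots> = real (D_of p k)"
    using assms by (subst powr_realpow) (simp_all add: D_of_def)
  finally show ?thesis by simp
qed

section \<open>Roots of unity and Fourier expansion on residues modulo \<open>D\<close>\<close>

lemma root_xi_power: "root_xi D ^ j = cis (2 * pi * real j / real D)"
proof -
  have "root_xi D = cis (2 * pi / real D)"
    by (simp add: root_xi_def cis_conv_exp mult_ac)
  then show ?thesis by (simp add: DeMoivre mult_ac)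
qed

lemma root_xi_power_eq_1: "0 < D \<Longrightarrow> root_xi D ^ D = 1"
  by (simp add: root_xi_power)

lemma root_xi_power_mod: "0 < D \<Longrightarrow> root_xi D ^ (m mod D) = root_xi D ^ m"
  by (metis div_mult_mod_eq mult.commute mult_1 power_add power_mult power_one root_xi_power_eq_1)

lemma root_xi_nonzero: "root_xi D \<noteq> 0"
  by (simp add: root_xi_def)

lemma inj_on_root_xi_power:
  assumes "0 < D"
  shows "inj_on (\<lambda>j. root_xi D ^ j) {..<D}"
  using bij_betw_roots_unity[OF assms] by (simp add: root_xi_power bij_betw_def)

text \<open>Orthogonality of the characters of the integers modulo \<open>D\<close>: the sum is a
  geometric sum in the \<open>D\<close>-th root of unity \<open>z\<close>, equal to \<open>D\<close>
  if \<open>z = 1\<close> and to 0 otherwise.\<close>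

lemma sum_root_xi_indicator:
  assumes "b < D"
  shows "(\<Sum>a<D. (inverse (root_xi D ^ b) ^ a / of_nat D) * (root_xi D ^ a) ^ m) =
         (if m mod D = b then 1 else 0)"
proof -
  define z where "z = root_xi D ^ m / root_xi D ^ b"
  have D: "0 < D" using assms by simp
  have "(\<Sum>a<D. (inverse (root_xi D ^ b) ^ a / of_nat D) * (root_xi D ^ a) ^ m) =
        (\<Sum>a<D. z ^ a) / of_nat D"
    unfolding sum_divide_distrib z_def
    by (intro sum.cong refl)
       (simp add: divide_inverse power_mult_distrib mult_ac flip: power_mult)
  also have "\<dots> = (if m mod D = b then 1 else 0)"
  proof (cases "m mod D = b")
    case True
    then have "z = 1"
      using root_xi_power_mod[OF D, of m] root_xi_nonzero[of D] by (simp add: z_def)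
    then show ?thesis using True D by simp
  next
    case False
    have "z \<noteq> 1"
    proof
      assume "z = 1"
      then have "root_xi D ^ (m mod D) = root_xi D ^ b"
        using root_xi_nonzero[of D] by (simp add: z_def root_xi_power_mod[OF D])
      with False show False
        using inj_on_root_xi_power[OF D] assms D by (auto dest: inj_onD)
    qed
    moreover have "(root_xi D ^ j) ^ D = 1" for j
      by (metis mult.commute power_mult power_one root_xi_power_eq_1[OF D])
    then have "z ^ D = 1" by (simp add: z_def power_divide)
    ultimately show ?thesis using False by (simp add: sum_gp_strict)
  qed
  finally show ?thesis .
qed

text \<open>Fourier inversion for functions of residue tuples indexed by \<open>B\<close>. One
  \<open>c\<close> works for all \<open>m\<close>; this is what later makes the coefficients
  independent of \<open>n\<close>.\<close>

lemma finite_fourier_expansion: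
  fixes g :: "('v \<Rightarrow> nat) \<Rightarrow> complex"
  assumes "finite B" and "0 < D"
  shows "\<exists>c. \<forall>m. g (\<lambda>v\<in>B. m v mod D) =
           (\<Sum>a\<in>B \<rightarrow>\<^sub>E {..<D}. c a * (\<Prod>v\<in>B. (root_xi D ^ a v) ^ m v))"
proof -
  define u where "u b a = inverse (root_xi D ^ b) ^ a / of_nat D" for a b :: nat
  \<comment> \<open>The normalised Fourier transform of \<open>g\<close>, since \<open>u b a\<close>
    is the conjugate character value divided by \<open>D\<close>.\<close>
  define c where "c a = (\<Sum>b\<in>B \<rightarrow>\<^sub>E {..<D}. g b * (\<Prod>v\<in>B. u (b v) (a v)))" for a
  have "g (\<lambda>v\<in>B. m v mod D) =
      (\<Sum>a\<in>B \<rightarrow>\<^sub>E {..<D}. c a * (\<Prod>v\<in>B. (root_xi D ^ a v) ^ m v))" for m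
  proof -
    let ?m = "\<lambda>v\<in>B. m v mod D"
    have fin: "finite (B \<rightarrow>\<^sub>E {..<D})" using assms by (intro finite_PiE) auto
    have "?m \<in> B \<rightarrow>\<^sub>E {..<D}" using assms by auto
    then have "g ?m = (\<Sum>b\<in>B \<rightarrow>\<^sub>E {..<D}. g b * (if b = ?m then 1 else 0))"
      using fin by (simp add: if_distrib[of "\<lambda>t. _ * t"] cong: if_cong)
    \<comment> \<open>Both tuples are extensional, so they are equal once they agree on
      \<open>B\<close>; the indicator of a tuple is thus a product of one-dimensional
      indicators.\<close>
    also have "\<dots> = (\<Sum>b\<in>B \<rightarrow>\<^sub>E {..<D}. g b * (\<Prod>v\<in>B. if m v mod D = b v then 1 else 0))"
    proof (intro sum.cong refl arg_cong2[where f = "(*)"])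
      fix b assume "b \<in> B \<rightarrow>\<^sub>E {..<D}"
      then have "b = ?m \<longleftrightarrow> (\<forall>v\<in>B. m v mod D = b v)"
        by (auto simp: fun_eq_iff PiE_def extensional_def)
      then show "(if b = ?m then 1 else 0) = (\<Prod>v\<in>B. if m v mod D = b v then 1 else (0::complex))"
        using assms(1) by (auto simp: prod_zero_iff intro!: prod.neutral)
    qed
    also have "\<dots> = (\<Sum>b\<in>B \<rightarrow>\<^sub>E {..<D}. g b *
        (\<Prod>v\<in>B. \<Sum>a<D. u (b v) a * (root_xi D ^ a) ^ m v))"
      by (intro sum.cong refl arg_cong2[where f = "(*)"] prod.cong)
         (auto simp del: times_divide_eq_left
          simp add: u_def sum_root_xi_indicator PiE_def Pi_def)
    \<comment> \<open>Multiplying out the product of sums yields one term per frequency tuple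
      \<open>a\<close>.\<close>
    also have "\<dots> = (\<Sum>b\<in>B \<rightarrow>\<^sub>E {..<D}. g b *
        (\<Sum>a\<in>B \<rightarrow>\<^sub>E {..<D}. \<Prod>v\<in>B. u (b v) (a v) * (root_xi D ^ a v) ^ m v))"
      using assms(1) by (subst prod_sum_PiE) auto
    also have "\<dots> = (\<Sum>a\<in>B \<rightarrow>\<^sub>E {..<D}. c a * (\<Prod>v\<in>B. (root_xi D ^ a v) ^ m v))"
      unfolding c_def sum_distrib_left sum_distrib_right
      by (subst sum.swap) (simp add: prod.distrib mult_ac)
    finally show ?thesis .
  qed
  then show ?thesis by blast
qed

section \<open>The exponential sum as a combination of \<open>n\<close>-th powers\<close>

lemma exp_sum_elem_sym_expansion:
  assumes "D = CHAR('a::finite_field) ^ e" and "k < D"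
  shows "\<exists>c. \<forall>n. exp_sum p r n (elem_sym n k :: (nat \<Rightarrow> 'a) \<Rightarrow> 'a) =
           (\<Sum>a\<in>(UNIV - {0 :: 'a}) \<rightarrow>\<^sub>E {..<D}. c a * (1 + (\<Sum>v\<in>UNIV - {0}. root_xi D ^ a v)) ^ n)"
proof -
  define \<psi> where "\<psi> y = exp (2 * of_real pi * \<i> / of_nat p * of_nat (trace_rep p r (y :: 'a)))" for y
  define g where "g b = \<psi> (coeff (\<Prod>v\<in>UNIV - {0}. [:1, v:] ^ b v) k)" for b
  obtain c where c: "\<And>m. g (\<lambda>v\<in>UNIV - {0}. m v mod D) =
      (\<Sum>a\<in>(UNIV - {0 :: 'a}) \<rightarrow>\<^sub>E {..<D}. c a * (\<Prod>v\<in>UNIV - {0}. (root_xi D ^ a v) ^ m v))"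
    using finite_fourier_expansion[of "UNIV - {0 :: 'a}" D g] assms(2) by auto
  \<comment> \<open>The weight 1 at the value 0 leaves the character unchanged and is the source of
    the summand 1 in the bases.\<close>
  define w where "w a v = (if v = 0 then 1 else root_xi D ^ a v)" for a and v :: 'a
  have summand: "\<psi> (elem_sym n k x) =
      (\<Sum>a\<in>(UNIV - {0 :: 'a}) \<rightarrow>\<^sub>E {..<D}. c a * (\<Prod>i\<in>{1..n}. w a (x i)))" for n x
  proof -
    define m where "m v = card {i\<in>{1..n}. x i = v}" for v
    have "elem_sym n k x = coeff (\<Prod>v\<in>UNIV. [:1, v:] ^ m v) k"
      unfolding elem_sym_eq_coeff m_def
      by (subst prod_eq_prod_power_card_fibre[where f = "\<lambda>v. [:1, v:]"]) simp_all
    also have "\<dots> = coeff (\<Prod>v\<in>UNIV - {0}. [:1, v:] ^ (m v mod D)) k"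
      by (rule coeff_prod_linear_power_mod[OF assms])
    \<comment> \<open>The polynomial inside \<open>g\<close> only reads its argument at nonzero
      values, so restricting the residue tuple is harmless.\<close>
    finally have "\<psi> (elem_sym n k x) = g (\<lambda>v\<in>UNIV - {0}. m v mod D)"
      by (simp add: g_def)
    also have "\<dots> = (\<Sum>a\<in>(UNIV - {0 :: 'a}) \<rightarrow>\<^sub>E {..<D}.
        c a * (\<Prod>v\<in>UNIV - {0}. (root_xi D ^ a v) ^ m v))"
      by (rule c)
    also have "\<dots> = (\<Sum>a\<in>(UNIV - {0 :: 'a}) \<rightarrow>\<^sub>E {..<D}. c a * (\<Prod>i\<in>{1..n}. w a (x i)))"
    proof (intro sum.cong refl arg_cong2[where f = "(*)"])
      fix a
      have "(\<Prod>i\<in>{1..n}. w a (x i)) = (\<Prod>v\<in>UNIV. w a v ^ m v)"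
        unfolding m_def by (rule prod_eq_prod_power_card_fibre) simp
      also have "\<dots> = (\<Prod>v\<in>UNIV - {0}. w a v ^ m v)"
        by (intro prod.mono_neutral_right) (auto simp: w_def)
      also have "\<dots> = (\<Prod>v\<in>UNIV - {0}. (root_xi D ^ a v) ^ m v)"
        by (intro prod.cong) (auto simp: w_def)
      finally show "(\<Prod>v\<in>UNIV - {0}. (root_xi D ^ a v) ^ m v) = (\<Prod>i\<in>{1..n}. w a (x i))" ..
    qed
    finally show ?thesis .
  qed
  have "exp_sum p r n (elem_sym n k :: (nat \<Rightarrow> 'a) \<Rightarrow> 'a) =
      (\<Sum>a\<in>(UNIV - {0 :: 'a}) \<rightarrow>\<^sub>E {..<D}. c a * (1 + (\<Sum>v\<in>UNIV - {0}. root_xi D ^ a v)) ^ n)" for n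
  proof -
    have "exp_sum p r n (elem_sym n k :: (nat \<Rightarrow> 'a) \<Rightarrow> 'a) =
        (\<Sum>x\<in>{1..n} \<rightarrow>\<^sub>E UNIV. \<psi> (elem_sym n k x))"
      by (simp add: exp_sum_def \<psi>_def)
    also have "\<dots> = (\<Sum>a\<in>(UNIV - {0 :: 'a}) \<rightarrow>\<^sub>E {..<D}.
        c a * (\<Sum>x\<in>{1..n} \<rightarrow>\<^sub>E UNIV. \<Prod>i\<in>{1..n}. w a (x i)))"
      unfolding summand sum_distrib_left by (rule sum.swap)
    \<comment> \<open>The coordinates of \<open>x\<close> vary independently, so the sum over all
      points splits into \<open>n\<close> equal factors.\<close>
    also have "\<dots> = (\<Sum>a\<in>(UNIV - {0 :: 'a}) \<rightarrow>\<^sub>E {..<D}. c a * (\<Sum>v\<in>UNIV. w a v) ^ n)"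
      by (subst prod_sum_PiE [symmetric]) simp_all
    also have "\<dots> = (\<Sum>a\<in>(UNIV - {0 :: 'a}) \<rightarrow>\<^sub>E {..<D}.
        c a * (1 + (\<Sum>v\<in>UNIV - {0}. root_xi D ^ a v)) ^ n)"
    proof (intro sum.cong refl arg_cong2[where f = "(*)"] arg_cong[where f = "\<lambda>z. z ^ n"])
      fix a
      show "(\<Sum>v\<in>UNIV. w a v) = 1 + (\<Sum>v\<in>UNIV - {0}. root_xi D ^ a v)"
        by (subst sum.remove[of _ 0]) (auto simp: w_def intro!: sum.cong)
    qed
    finally show ?thesis .
  qed
  then show ?thesis by blast
qed

section \<open>Integrality of sums of roots of unity\<close>

text \<open>The sum is an eigenvalue of an integer matrix, hence a root of its characteristic
  polynomial, which is monic with integer coefficients.\<close>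

lemma algebraic_int_sum_powers_root_of_unity:
  fixes z :: "'a::field_char_0"
  assumes "0 < D" and "z ^ D = 1" and "finite V"
  shows "algebraic_int (\<Sum>v\<in>V. z ^ (a v))"
proof -
  define l where "l = (\<Sum>v\<in>V. z ^ (a v))"
  \<comment> \<open>\<open>A\<close> is a sum of cyclic shifts: row \<open>i\<close> records the
    product of \<open>z ^ i\<close> with the sum, exponents being reduced modulo \<open>D\<close>.
    Hence the vector of powers of \<open>z\<close> is an eigenvector.\<close>
  define A :: "int mat" where
    "A = mat D D (\<lambda>(i, j). \<Sum>v\<in>V. if j = (i + a v) mod D then 1 else 0)"
  define x where "x = vec D (\<lambda>j. z ^ j)"
  have A: "A \<in> carrier_mat D D" by (simp add: A_def)
  have z_mod: "z ^ (m mod D) = z ^ m" for m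
    by (metis assms(2) div_mult_mod_eq mult.commute mult_1 power_add power_mult power_one)
  have "eigenvector (map_mat of_int A) x l"
    unfolding eigenvector_def
  proof (intro conjI)
    show "x \<noteq> 0\<^sub>v (dim_row (map_mat of_int A))"
    proof
      assume "x = 0\<^sub>v (dim_row (map_mat of_int A))"
      then have "x $ 0 = 0" using assms(1) by (simp add: A_def)
      then show False using assms(1) by (simp add: x_def)
    qed
    show "map_mat of_int A *\<^sub>v x = l \<cdot>\<^sub>v x"
    proof (rule eq_vecI)
      fix i assume "i < dim_vec (l \<cdot>\<^sub>v x)"
      then have i: "i < D" by (simp add: x_def)
      have "(map_mat of_int A *\<^sub>v x) $ i =
          (\<Sum>j<D. (\<Sum>v\<in>V. if j = (i + a v) mod D then 1 else 0) * z ^ j)"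
        using i by (simp add: A_def x_def scalar_prod_def lessThan_atLeast0 of_int_sum
            if_distrib[of of_int] cong: if_cong)
      also have "\<dots> = (\<Sum>v\<in>V. \<Sum>j<D. (if j = (i + a v) mod D then 1 else 0) * z ^ j)"
        unfolding sum_distrib_right by (rule sum.swap)
      also have "\<dots> = (\<Sum>v\<in>V. z ^ ((i + a v) mod D))"
        using assms(1) by (intro sum.cong refl) (simp add: if_distrib[of "\<lambda>t. t * _"] cong: if_cong)
      also have "\<dots> = l * z ^ i"
        by (simp add: z_mod l_def power_add sum_distrib_left mult_ac)
      also have "\<dots> = (l \<cdot>\<^sub>v x) $ i" using i by (simp add: x_def)
      finally show "(map_mat of_int A *\<^sub>v x) $ i = (l \<cdot>\<^sub>v x) $ i" .
    qed (simp add: A_def x_def)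
  qed (simp add: A_def x_def)
  then have "poly (char_poly (map_mat of_int A)) l = 0"
    using A by (subst eigenvalue_root_char_poly[symmetric, where n = D]) (auto simp: eigenvalue_def)
  then have "poly (map_poly of_int (char_poly A)) l = 0"
    by (simp add: of_int_hom.char_poly_hom[OF A])
  moreover have "lead_coeff (char_poly A) = 1"
    using degree_monic_char_poly[OF A] by simp
  ultimately show ?thesis
    unfolding algebraic_int_altdef_ipoly l_def by blast
qed

section \<open>Gauss's lemma for monic divisors\<close>

lemma rat_poly_clear_denominators:
  fixes P :: "rat poly"
  obtains d :: int and R where "0 < d" and "map_poly of_int R = smult (of_int d) P"
proof -
  define d where "d = (\<Prod>i\<le>degree P. snd (quotient_of (coeff P i)))"
  have "0 < d" unfolding d_def by (intro prod_pos) (auto intro: quotient_of_denom_pos')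
  have "of_int d * coeff P i \<in> \<int>" for i
  proof (cases "i \<le> degree P")
    case True
    then have "snd (quotient_of (coeff P i)) dvd d" unfolding d_def by (intro dvd_prodI) auto
    then obtain e where e: "d = snd (quotient_of (coeff P i)) * e" by (elim dvdE)
    have "coeff P i = of_int (fst (quotient_of (coeff P i))) / of_int (snd (quotient_of (coeff P i)))"
      by (rule quotient_of_div) simp
    moreover have "snd (quotient_of (coeff P i)) > 0" by (rule quotient_of_denom_pos')
    ultimately have "of_int d * coeff P i = of_int (fst (quotient_of (coeff P i)) * e)"
      unfolding e by (simp add: field_simps)
    then show ?thesis by (metis Ints_of_int)
  qed (simp add: coeff_eq_0)
  then have "\<And>i. coeff (smult (of_int d) P) i \<in> \<int>" by simp
  then obtain R where "smult (of_int d) P = map_poly of_int R" by (rule intpolyE)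
  then show ?thesis using that[OF \<open>0 < d\<close>] by metis
qed

text \<open>Clear denominators in \<open>P\<close> and in its cofactor and compare contents.
  Monicity makes the multipliers \<open>d\<close> and \<open>d'\<close> leading coefficients, so
  they are multiples of the contents; multiplicativity of the content then forces equality up to
  units.\<close>

lemma monic_dvd_int_poly:
  fixes P :: "rat poly" and Q :: "int poly"
  assumes dvd: "P dvd map_poly of_int Q" and "lead_coeff P = 1" and "lead_coeff Q = 1"
  obtains R :: "int poly" where "P = map_poly of_int R"
proof -
  obtain P' where P': "map_poly of_int Q = P * P'" using dvd by (elim dvdE)
  have lc: "lead_coeff P' = 1"
    using arg_cong[OF P', of lead_coeff] assms(2,3) by (simp add: lead_coeff_mult)
  obtain d R where R: "0 < d" "map_poly of_int R = smult (of_int d) P"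
    by (rule rat_poly_clear_denominators)
  obtain d' R' where R': "0 < d'" "map_poly of_int R' = smult (of_int d') P'"
    by (rule rat_poly_clear_denominators)
  have cd: "content R dvd d"
  proof -
    have "of_int (lead_coeff R) = (of_int d :: rat)"
      using arg_cong[OF R(2), of lead_coeff] assms(2) by simp
    then show ?thesis by (metis content_dvd_coeff of_int_eq_iff)
  qed
  have cd': "content R' dvd d'"
  proof -
    have "of_int (lead_coeff R') = (of_int d' :: rat)"
      using arg_cong[OF R'(2), of lead_coeff] lc by simp
    then show ?thesis by (metis content_dvd_coeff of_int_eq_iff)
  qed
  have "content Q = 1"
  proof -
    have "content Q dvd 1" using content_dvd_coeff[of Q "degree Q"] assms(3) by simp
    then show ?thesis by (metis is_unit_content_iff)
  qed
  have "(map_poly of_int (R * R') :: rat poly) = map_poly of_int (smult (d * d') Q)"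
    by (simp add: R R' P' hom_distribs mult_ac)
  then have "R * R' = smult (d * d') Q" by simp
  \<comment> \<open>\<open>Q\<close> is primitive, so the content of the right-hand side is just the
    scalar.\<close>
  then have "content R * content R' = d * d'"
    using \<open>0 < d\<close> \<open>0 < d'\<close> \<open>content Q = 1\<close> by (metis content_mult content_smult mult.right_neutral
      abs_of_pos mult_pos_pos normalize_int_def normalize_mult)
  moreover obtain e where e: "d = content R * e" using cd by (elim dvdE)
  moreover obtain e' where e': "d' = content R' * e'" using cd' by (elim dvdE)
  ultimately have "content R * content R' * (e * e') = content R * content R' * 1" 
    by (simp add: mult_ac)
  moreover have "content R * content R' \<noteq> 0"
    using \<open>0 < d\<close> \<open>0 < d'\<close> e e' by auto
  ultimately have "e * e' = 1" by (metis mult_cancel_left)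
  then have "is_unit e" by (metis dvd_triv_left)
  \<comment> \<open>Now \<open>d\<close> divides every coefficient of \<open>R\<close>, and the
    quotient is the integer form of \<open>P\<close>.\<close>
  then have "d dvd content R" unfolding e by (simp add: mult_unit_dvd_iff)
  then have "[:d:] dvd R" by (simp add: const_poly_dvd_iff_dvd_content)
  then obtain S where "R = [:d:] * S" by (elim dvdE)
  then have "R = smult d S" by simp
  then have "smult (of_int d) (map_poly of_int S) = smult (of_int d) P"
    using R(2) by (simp add: hom_distribs)
  then have "smult (inverse (of_int d)) (smult (of_int d) (map_poly of_int S)) =
      smult (inverse (of_int d)) (smult (of_int d) P)" by (rule arg_cong)
  then have "P = map_poly of_int S" using \<open>0 < d\<close> by simp
  then show ?thesis by (rule that)
qed

section \<open>Minimal polynomials over the rationals\<close>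

interpretation of_rat_poly_hom: map_poly_idom_hom "of_rat :: rat \<Rightarrow> complex" ..

text \<open>Any nonzero annihilator \<open>Q0\<close> of \<open>z\<close> makes the definite
  description meaningful: an annihilator of least degree, scaled to be monic, exists and is
  unique.\<close>

lemma min_poly_rat_properties:
  assumes "Q0 \<noteq> 0" and "poly (map_poly of_rat Q0) z = 0"
  shows lead_coeff_min_poly_rat: "lead_coeff (min_poly_rat z) = 1"
    and poly_min_poly_rat: "poly (map_poly of_rat (min_poly_rat z)) z = 0"
    and degree_min_poly_rat_le:
      "\<And>Q. Q \<noteq> 0 \<Longrightarrow> poly (map_poly of_rat Q) z = 0 \<Longrightarrow> degree (min_poly_rat z) \<le> degree Q"
proof -
  let ?R = "\<lambda>Q :: rat poly. Q \<noteq> 0 \<and> poly (map_poly of_rat Q) z = 0"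
  define P0 where "P0 = arg_min degree ?R"
  have P0: "?R P0" "\<And>Q. ?R Q \<Longrightarrow> degree P0 \<le> degree Q"
    using arg_min_nat_lemma[of ?R Q0 degree] assms by (auto simp: P0_def)
  define P where "P = smult (inverse (lead_coeff P0)) P0"
  let ?M = "\<lambda>P. lead_coeff P = 1 \<and> poly (map_poly of_rat P) z = 0 \<and>
     (\<forall>Q. Q \<noteq> 0 \<and> poly (map_poly of_rat Q) z = 0 \<longrightarrow> degree P \<le> degree Q)"
  have M: "?M P" using P0 by (auto simp: P_def hom_distribs)
  have "?M (min_poly_rat z)"
    unfolding min_poly_rat_def
  proof (rule theI)
    fix Q assume Q: "?M Q"
    show "Q = P"
    proof (rule ccontr)
      assume "Q \<noteq> P"
      have "P \<noteq> 0" "Q \<noteq> 0" using M Q by auto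
      then have deg: "degree P = degree Q" using M Q by (auto intro: antisym)
      have "poly (map_poly of_rat (Q - P)) z = 0"
        using M Q by (simp add: of_rat_poly_hom.hom_minus)
      then have "degree P \<le> degree (Q - P)"
        using M \<open>Q \<noteq> P\<close> by (metis right_minus_eq)
      moreover have "degree (Q - P) \<le> degree P" using deg by (simp add: degree_diff_le)
      \<comment> \<open>The leading terms cancel, although minimality forces the nonzero difference
        to have the full degree.\<close>
      moreover have "coeff (Q - P) (degree P) = 0" using M Q deg by simp
      ultimately have "coeff (Q - P) (degree (Q - P)) = 0" by simp
      then show False using \<open>Q \<noteq> P\<close> by (metis leading_coeff_0_iff right_minus_eq)
    qed
  qed (rule M)
  then show "lead_coeff (min_poly_rat z) = 1"
    and "poly (map_poly of_rat (min_poly_rat z)) z = 0"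
    and "\<And>Q. Q \<noteq> 0 \<Longrightarrow> poly (map_poly of_rat Q) z = 0 \<Longrightarrow> degree (min_poly_rat z) \<le> degree Q"
    by blast+
qed

text \<open>The remainder of \<open>Q\<close> also vanishes at \<open>z\<close>, so minimality of
  the degree makes it zero.\<close>

lemma min_poly_rat_dvd:
  assumes "poly (map_poly of_rat Q) z = 0"
  shows "min_poly_rat z dvd Q"
proof (cases "Q = 0")
  case False
  note M = min_poly_rat_properties[OF False assms]
  let ?S = "Q mod min_poly_rat z"
  have "map_poly of_rat Q = (map_poly of_rat (Q div min_poly_rat z) :: complex poly) *
      map_poly of_rat (min_poly_rat z) + map_poly of_rat ?S"
    by (metis div_mult_mod_eq of_rat_poly_hom.hom_add of_rat_poly_hom.hom_mult)
  then have "poly (map_poly of_rat ?S) z = 0" using M(2) assms by simp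
  then have "?S = 0"
    using M(1) M(3)[of ?S] degree_mod_less[of "min_poly_rat z" Q] by fastforce
  then show ?thesis by auto
qed simp

section \<open>From frequencies on field elements to decreasing sequences\<close>

text \<open>Bridges two indexings: Fourier frequencies are attached to nonzero field elements, while
  \<open>chi_poly\<close> ranges over decreasing sequences on \<open>{1..q-1}\<close>. Sorting the
  values does not affect the sum.\<close>

lemma sum_antimono_enumeration:
  fixes a :: "'v \<Rightarrow> nat"
  assumes "finite B"
  obtains b where "\<And>i. i \<in> {1..card B} \<Longrightarrow> b i \<in> a ` B"
    and "\<And>i j. i \<in> {1..card B} \<Longrightarrow> j \<in> {1..card B} \<Longrightarrow> i \<le> j \<Longrightarrow> b j \<le> b i"
    and "\<And>f. (\<Sum>v\<in>B. f (a v)) = (\<Sum>i=1..card B. f (b i) :: 'b::comm_monoid_add)"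
proof -
  obtain vs where vs: "set vs = B" "distinct vs" using assms finite_distinct_list by blast
  \<comment> \<open>List positions start at 0 and the target indices at 1, whence the shift
    \<open>i - 1\<close> below.\<close>
  define ys where "ys = rev (sort (map a vs))"
  have len: "length ys = card B" using vs distinct_card[of vs] by (simp add: ys_def)
  have "ys ! (i - 1) \<in> a ` B" if "i \<in> {1..card B}" for i
  proof -
    have "ys ! (i - 1) \<in> set ys" using that len by (intro nth_mem) auto
    then show ?thesis using vs by (simp add: ys_def)
  qed
  moreover have "ys ! (j - 1) \<le> ys ! (i - 1)"
    if "i \<in> {1..card B}" "j \<in> {1..card B}" "i \<le> j" for i j
    using that len by (intro sorted_rev_nth_mono) (auto simp: ys_def)
  moreover have "(\<Sum>v\<in>B. f (a v)) = (\<Sum>i=1..card B. f (ys ! (i - 1)))" for f :: "nat \<Rightarrow> 'b"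
  proof -
    have "(\<Sum>v\<in>B. f (a v)) = sum_list (map f (map a vs))"
      using vs by (simp add: sum_list_distinct_conv_sum_set o_def)
    also have "\<dots> = sum_list (map f ys)"
      by (metis (no_types) ys_def mset_map mset_rev mset_sort sum_mset_sum_list)
    also have "\<dots> = (\<Sum>i<card B. f (ys ! i))"
      by (simp add: sum_list_sum_nth len lessThan_atLeast0)
    also have "\<dots> = (\<Sum>i=1..card B. f (ys ! (i - 1)))"
      by (rule sum.reindex_bij_witness[of _ "\<lambda>i. i - 1" Suc]) auto
    finally show ?thesis .
  qed
  ultimately show ?thesis by (rule that[of "\<lambda>i. ys ! (i - 1)"])
qed


section \<open>The least common multiple of minimal polynomials of algebraic integers\<close>

lemma algebraic_int_poly_rat:
  fixes z :: complex
  assumes "algebraic_int z"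
  obtains Q :: "int poly" where "lead_coeff Q = 1"
    and "poly (map_poly of_rat (map_poly of_int Q)) z = 0"
proof -
  obtain Q :: "int poly" where Q: "lead_coeff Q = 1" "poly (map_poly of_int Q) z = 0"
    using assms unfolding algebraic_int_altdef_ipoly by blast
  have "map_poly of_rat (map_poly of_int Q) = (map_poly of_int Q :: complex poly)"
    by (simp add: map_poly_map_poly o_def)
  then show ?thesis using Q that by metis
qed

lemma poly_Lcm_min_poly_rat:
  assumes "algebraic_int z" and "z \<in> Z"
  shows "poly (map_poly of_rat (Lcm (min_poly_rat ` Z))) z = 0"
proof -
  obtain Q :: "int poly" where Q: "lead_coeff Q = 1" "poly (map_poly of_rat (map_poly of_int Q)) z = 0"
    using algebraic_int_poly_rat assms(1) by blast
  have "map_poly of_int Q \<noteq> (0 :: rat poly)" using Q(1) by auto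
  then have "poly (map_poly of_rat (min_poly_rat z)) z = 0"
    using Q(2) by (rule poly_min_poly_rat)
  moreover have "min_poly_rat z dvd Lcm (min_poly_rat ` Z)"
    using assms(2) by (intro dvd_Lcm) auto
  then obtain K where "Lcm (min_poly_rat ` Z) = min_poly_rat z * K" by (elim dvdE)
  ultimately show ?thesis by (simp add: of_rat_poly_hom.hom_mult)
qed

text \<open>The product of monic integer annihilators, one for each \<open>z\<close>, is a common
  multiple of the minimal polynomials. The lcm is a monic divisor of it, so Gauss's lemma
  applies.\<close>

lemma Lcm_min_poly_rat_integral:
  assumes "finite Z" and "\<And>z. z \<in> Z \<Longrightarrow> algebraic_int z"
  obtains P :: "int poly" where "lead_coeff P = 1" and "Lcm (min_poly_rat ` Z) = map_poly of_int P"
proof -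
  define L where "L = Lcm (min_poly_rat ` Z)"
  have "\<exists>Q :: int poly. lead_coeff Q = 1 \<and> poly (map_poly of_rat (map_poly of_int Q)) z = 0"
    if "z \<in> Z" for z
    using algebraic_int_poly_rat[OF assms(2)[OF that]] by metis
  then obtain Q :: "complex \<Rightarrow> int poly" where
    Q: "\<And>z. z \<in> Z \<Longrightarrow> lead_coeff (Q z) = 1"
       "\<And>z. z \<in> Z \<Longrightarrow> poly (map_poly of_rat (map_poly of_int (Q z))) z = 0"
    by metis
  define R where "R = (\<Prod>z\<in>Z. Q z)"
  have R: "lead_coeff R = 1" unfolding R_def lead_coeff_prod by (simp add: Q)
  have "L dvd map_poly of_int R"
    unfolding L_def
  proof (rule Lcm_least)
    fix M assume "M \<in> min_poly_rat ` Z"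
    then obtain z where z: "z \<in> Z" "M = min_poly_rat z" by auto
    have "M dvd map_poly of_int (Q z)" unfolding z(2) using Q(2)[OF z(1)] by (rule min_poly_rat_dvd)
    also have "(map_poly of_int (Q z) :: rat poly) dvd map_poly of_int R"
      unfolding R_def using assms(1) z(1) by (intro of_int_poly_hom.hom_dvd dvd_prodI)
    finally show "M dvd map_poly of_int R" .
  qed
  moreover from this have "L \<noteq> 0" using R by auto
  then have "lead_coeff L = 1"
  proof -
    \<comment> \<open>Over a field, a nonzero normalised polynomial is monic.\<close>
    have "normalize L = L" by (simp add: L_def)
    moreover have "coeff (normalize L) (degree L) = 1" using \<open>L \<noteq> 0\<close> by simp
    ultimately show ?thesis by metis
  qed
  ultimately obtain P :: "int poly" where P: "L = map_poly of_int P"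
    using R by (rule monic_dvd_int_poly)
  then have "lead_coeff P = 1" using \<open>lead_coeff L = 1\<close> by simp
  then show ?thesis using P that by (simp add: L_def)
qed

section \<open>Linear recurrences from monic integer polynomials\<close>

lemma rec_char_poly_monic:
  assumes "lead_coeff P = 1"
  shows "rec_char_poly (degree P) (\<lambda>i. - coeff P i) = P"
proof (rule poly_eqI)
  fix j
  have "coeff (rec_char_poly (degree P) (\<lambda>i. - coeff P i)) j =
      (if j = degree P then 1 else 0) + (\<Sum>i<degree P. if i = j then coeff P i else 0)"
    by (auto simp: rec_char_poly_def coeff_sum simp flip: sum_negf intro!: sum.cong)
  also have "\<dots> = coeff P j"
    using assms by (cases j "degree P" rule: linorder_cases) (simp_all add: coeff_eq_0)
  finally show "coeff (rec_char_poly (degree P) (\<lambda>i. - coeff P i)) j = coeff P j" .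
qed

text \<open>Each geometric sequence with ratio a root of \<open>P\<close> satisfies the recurrence,
  and the recurrence is linear. The signs are negated because \<open>rec_char_poly\<close> subtracts
  the lower terms.\<close>

lemma satisfies_int_recurrence_exponential_sum:
  assumes monic: "lead_coeff P = 1"
    and root: "\<And>a. a \<in> A \<Longrightarrow> poly (map_poly of_int P) (l a) = 0"
    and s: "\<And>n. s n = (\<Sum>a\<in>A. c a * l a ^ n)"
  shows "satisfies_int_recurrence s (degree P) (\<lambda>i. - coeff P i)"
proof -
  have "s (n + degree P) = (\<Sum>i<degree P. of_int (- coeff P i) * s (n + i))" for n
  proof -
    have "(\<Sum>i\<le>degree P. of_int (coeff P i) * s (n + i)) =
        (\<Sum>a\<in>A. \<Sum>i\<le>degree P. of_int (coeff P i) * (c a * l a ^ (n + i)))"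
      unfolding s sum_distrib_left by (rule sum.swap)
    also have "\<dots> = (\<Sum>a\<in>A. c a * l a ^ n * poly (map_poly of_int P) (l a))"
      by (simp add: poly_altdef sum_distrib_left power_add mult_ac)
    also have "\<dots> = 0" using root by simp
    finally have "(\<Sum>i<degree P. of_int (coeff P i) * s (n + i)) + s (n + degree P) = 0"
      using monic by (simp flip: lessThan_Suc_atMost)
    then show ?thesis by (simp add: sum_negf add_eq_0_iff)
  qed
  then show ?thesis by (simp add: satisfies_int_recurrence_def)
qed

section \<open>The bases of the expansion as roots of the characteristic polynomial\<close>

theorem theorem4p16:
  fixes p r k :: nat
  assumes "prime p" and "r \<ge> 1" and "CARD('a::finite_field) = p ^ r" and "k > 1"
  shows "\<exists>d c. map_poly of_int (rec_char_poly d c) = chi_poly p (p ^ r) k \<and>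
           satisfies_int_recurrence
             (\<lambda>n. exp_sum p r n (elem_sym n k :: (nat \<Rightarrow> 'a) \<Rightarrow> 'a)) d c"
proof -
  define q where "q = p ^ r"
  define D where "D = D_of p k"
  have "k < D"
    using less_D_of[of p k] prime_gt_1_nat[OF assms(1)] assms(4) by (simp add: D_def)
  then have "0 < D" by simp
  have "D = CHAR('a) ^ (nat \<lfloor>log (real p) (real k)\<rfloor> + 1)"
    using CHAR_eq_of_card_prime_power[OF assms(1,3)] by (simp add: D_def D_of_def)
  from exp_sum_elem_sym_expansion[OF this \<open>k < D\<close>, of p r]
  obtain c where c: "\<And>n. exp_sum p r n (elem_sym n k :: (nat \<Rightarrow> 'a) \<Rightarrow> 'a) =
      (\<Sum>a\<in>(UNIV - {0 :: 'a}) \<rightarrow>\<^sub>E {..<D}. c a * (1 + (\<Sum>v\<in>UNIV - {0}. root_xi D ^ a v)) ^ n)"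
    by blast
  define adm where "adm = (\<lambda>a :: nat \<Rightarrow> nat. (\<forall>i\<in>{1..q-1}. a i \<le> D - 1) \<and>
     (\<forall>i\<in>{1..q-1}. \<forall>j\<in>{1..q-1}. i \<le> j \<longrightarrow> a j \<le> a i))"
  define l where "l a = 1 + (\<Sum>i=1..q-1. root_xi D ^ a i)" for a
  define Z where "Z = l ` Collect adm"
  have chi: "chi_poly p q k = Lcm (min_poly_rat ` Z)"
    by (simp only: chi_poly_def M_poly_def Z_def image_image adm_def l_def D_def setcompr_eq_image)
  \<comment> \<open>Infinitely many \<open>a\<close> are admissible, but \<open>l\<close> only reads
    the entries at \<open>{1..q-1}\<close>, so \<open>Z\<close> is finite.\<close>
  have "Z \<subseteq> l ` ({1..q-1} \<rightarrow>\<^sub>E {..D-1})"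
  proof
    fix z assume "z \<in> Z"
    then obtain a where a: "adm a" "z = l a" by (auto simp: Z_def)
    have "l a = l (restrict a {1..q-1})" by (simp add: l_def)
    moreover have "restrict a {1..q-1} \<in> {1..q-1} \<rightarrow>\<^sub>E {..D-1}" using a(1) by (auto simp: adm_def)
    ultimately show "z \<in> l ` ({1..q-1} \<rightarrow>\<^sub>E {..D-1})" using a(2) by blast
  qed
  then have "finite Z" by (rule finite_subset) (intro finite_imageI finite_PiE, auto)
  have int: "algebraic_int z" if z: "z \<in> Z" for z
  proof -
    obtain a where a: "z = l a" using z by (auto simp: Z_def)
    \<comment> \<open>The summand 1 is the power with exponent 0, placed at the spare index 0, so
      that \<open>z\<close> becomes a plain sum of powers.\<close>
    define a' where "a' = a(0 := 0)"
    have "algebraic_int (\<Sum>i\<in>insert 0 {1..q-1}. root_xi D ^ a' i)"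
      using \<open>0 < D\<close> root_xi_power_eq_1[OF \<open>0 < D\<close>]
      by (rule algebraic_int_sum_powers_root_of_unity) simp
    also have "(\<Sum>i\<in>insert 0 {1..q-1}. root_xi D ^ a' i) = z"
      by (simp add: a l_def a'_def)
    finally show ?thesis .
  qed
  obtain P :: "int poly" where P: "lead_coeff P = 1" "Lcm (min_poly_rat ` Z) = map_poly of_int P"
    using Lcm_min_poly_rat_integral[OF \<open>finite Z\<close> int] by blast
  have "poly (map_poly of_int P) (1 + (\<Sum>v\<in>UNIV - {0}. root_xi D ^ a v)) = 0"
    if a: "a \<in> (UNIV - {0 :: 'a}) \<rightarrow>\<^sub>E {..<D}" for a
  proof -
    have card: "card (UNIV - {0 :: 'a}) = q - 1"
      using assms(3) by (simp add: card_Diff_singleton q_def)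
    obtain b where b: "\<And>i. i \<in> {1..q-1} \<Longrightarrow> b i \<in> a ` (UNIV - {0})"
      "\<And>i j. i \<in> {1..q-1} \<Longrightarrow> j \<in> {1..q-1} \<Longrightarrow> i \<le> j \<Longrightarrow> b j \<le> b i"
      "\<And>f. (\<Sum>v\<in>UNIV - {0}. f (a v)) = (\<Sum>i=1..q-1. f (b i) :: complex)"
      by (rule sum_antimono_enumeration[of "UNIV - {0 :: 'a}" a, unfolded card]) auto
    \<comment> \<open>The sorted frequencies are admissible, so every base of the expansion lies in
      \<open>Z\<close> and is a root of the lcm.\<close>
    have "b i \<le> D - 1" if "i \<in> {1..q-1}" for i
      using b(1)[OF that] a by (fastforce simp: PiE_def Pi_def)
    then have "adm b" using b(2) by (simp add: adm_def)
    moreover have "1 + (\<Sum>v\<in>UNIV - {0}. root_xi D ^ a v) = l b"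
      by (simp add: l_def b(3)[of "\<lambda>j. root_xi D ^ j"])
    ultimately have mem: "1 + (\<Sum>v\<in>UNIV - {0}. root_xi D ^ a v) \<in> Z" by (simp add: Z_def)
    have "poly (map_poly of_rat (map_poly of_int P)) (1 + (\<Sum>v\<in>UNIV - {0}. root_xi D ^ a v)) = 0"
      using poly_Lcm_min_poly_rat[OF int[OF mem] mem] unfolding P(2) .
    then show ?thesis by (simp add: map_poly_map_poly o_def)
  qed
  then have "satisfies_int_recurrence (\<lambda>n. exp_sum p r n (elem_sym n k :: (nat \<Rightarrow> 'a) \<Rightarrow> 'a))
      (degree P) (\<lambda>i. - coeff P i)"
    using satisfies_int_recurrence_exponential_sum[OF P(1) _ c] by blast
  moreover have "map_poly of_int (rec_char_poly (degree P) (\<lambda>i. - coeff P i)) = chi_poly p (p ^ r) k"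
    using rec_char_poly_monic[OF P(1)] P(2) chi by (simp add: q_def)
  ultimately show ?thesis by blast
qed

end
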